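(* $\xi_{n,2}=1-\dfrac{1}{n}$ for every integer $n\geq 2$.
   Context: Let $X$ be a finite alphabet with $n\ge 2$ letters. For positive integers $a,b$, a code with length distribution $(a,b)$ is a pair $(v_1,v_2)$ of words over $X$ with $|v_1|=a$ and $|v_2|=b$. It is a prefix code if $v_1\neq v_2$ and neither word is a prefix (initial segment) of the other. It is uniquely decodable if $v_{i_1}v_{i_2}\cdots v_{i_t}=v_{j_1}v_{j_2}\cdots v_{j_{t'}}$ with $t,t'\geq 1$ and all indices in $\{1,2\}$ implies $t=t'$ and $i_s=j_s$ for every $1\leq s\leq t$. $UD_n((a,b))$ denotes the set of uniquely decodable codes over an $n$-letter alphabet with length distribution $(a,b)$, and $PR_n((a,b))\subseteq UD_n((a,b))$ the subset of prefix codes. Define $$\xi_{n,2}:=\inf_{L}\frac{|PR_n(L)|}{|UD_n(L)|},$$ where the infimum is over all pairs $L=(a,b)$ of positive integers for which $UD_n(L)\neq\emptyset$. *)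

theory Defs
  imports Complex_Main "HOL-Library.Sublist"
begin

definition codes :: "'a set \<Rightarrow> nat \<times> nat \<Rightarrow> ('a list \<times> 'a list) set" where
  "codes X L = {(v1, v2). v1 \<in> lists X \<and> v2 \<in> lists X \<and> length v1 = fst L \<and> length v2 = snd L}"

definition is_prefix_code :: "'a list \<times> 'a list \<Rightarrow> bool" where
  "is_prefix_code v \<longleftrightarrow> fst v \<noteq> snd v \<and> \<not> prefix (fst v) (snd v) \<and> \<not> prefix (snd v) (fst v)"

text \<open>Only the indices \<open>1\<close> and \<open>2\<close> are meaningful.\<close>
definition codeword :: "'a list \<times> 'a list \<Rightarrow> nat \<Rightarrow> 'a list" where
  "codeword v i = (if i = 1 then fst v else snd v)"

definition is_uniquely_decodable :: "'a list \<times> 'a list \<Rightarrow> bool" where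
  "is_uniquely_decodable v \<longleftrightarrow>
    (\<forall>is js. is \<noteq> [] \<and> js \<noteq> [] \<and> set is \<subseteq> {1, 2} \<and> set js \<subseteq> {1, 2} \<and>
       concat (map (codeword v) is) = concat (map (codeword v) js) \<longrightarrow> is = js)"

definition UD :: "'a set \<Rightarrow> nat \<times> nat \<Rightarrow> ('a list \<times> 'a list) set" where
  "UD X L = {v \<in> codes X L. is_uniquely_decodable v}"

definition PR :: "'a set \<Rightarrow> nat \<times> nat \<Rightarrow> ('a list \<times> 'a list) set" where
  "PR X L = {v \<in> codes X L. is_prefix_code v}"

definition xi2 :: "'a set \<Rightarrow> real" where
  "xi2 X = (INF L \<in> {(a, b). a > 0 \<and> b > 0 \<and> UD X (a, b) \<noteq> {}}.
              real (card (PR X L)) / real (card (UD X L)))"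

lemma is_prefix_code_imp_uniquely_decodable:
  assumes "is_prefix_code v"
  shows "is_uniquely_decodable v"
proof -
  have ne: "codeword v i \<noteq> []" for i
    using assms by (auto simp: is_prefix_code_def codeword_def)
  have pre: "i = j" if i: "i \<in> {1, 2}" and j: "j \<in> {1, 2}"
    and eq: "codeword v i @ xs = codeword v j @ ys" for i j :: nat and xs ys
  proof (rule ccontr)
    assume "i \<noteq> j"
    have "prefix (codeword v i) (codeword v j @ ys)" "prefix (codeword v j) (codeword v j @ ys)"
      unfolding eq[symmetric] by (rule prefixI, rule refl) (simp add: eq)
    then have "prefix (codeword v i) (codeword v j) \<or> prefix (codeword v j) (codeword v i)"
      by (rule prefix_same_cases)
    moreover have "i = 1 \<and> j = 2 \<or> i = 2 \<and> j = 1"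
      using i j \<open>i \<noteq> j\<close> by blast
    ultimately show False
      using assms by (elim disjE conjE) (simp_all add: is_prefix_code_def codeword_def)
  qed
  have "is = js" if "set is \<subseteq> {1, 2}" "set js \<subseteq> {1, 2}"
    "concat (map (codeword v) is) = concat (map (codeword v) js)" for "is" js
    using that
  proof (induction "is" arbitrary: js)
    case Nil
    then show ?case using ne by (cases js) auto
  next
    case (Cons i "is")
    obtain j js' where js: "js = j # js'"
      using Cons.prems(3) ne by (cases js) simp_all
    have "codeword v i @ concat (map (codeword v) is) = codeword v j @ concat (map (codeword v) js')"
      using Cons.prems(3) js by simp
    moreover have "i \<in> {1, 2}" "j \<in> {1, 2}" using Cons.prems(1,2) js by simp_all
    ultimately have "i = j" using pre by blast
    moreover have "is = js'"
      using Cons.prems js \<open>i = j\<close> by (intro Cons.IH) simp_all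
    ultimately show ?case using js by simp
  qed
  then show ?thesis unfolding is_uniquely_decodable_def by blast
qed

lemma PR_subset_UD: "PR X L \<subseteq> UD X L"
  using is_prefix_code_imp_uniquely_decodable by (auto simp: PR_def UD_def)

end

theory Submission
  imports Defs
begin

text \<open>Two words form a uniquely decodable code iff they do not commute: if \<open>v = u @ z\<close>, the code
  \<open>(u, v)\<close> arises from the shorter code \<open>(u, z)\<close> by composition with \<open>([1], [1, 2])\<close>, so a Euclidean
  descent ends in a prefix code. Commuting words are powers of a common word of length \<open>gcd a b\<close>,
  whereas the words of a pair that is not a prefix code are both initial segments of the longer one.
  Hence \<open>card UD = n ^ (a + b) - n ^ gcd a b\<close> and \<open>card PR = n ^ (a + b) - n ^ max a b\<close>. Already
  \<open>card PR / n ^ (a + b)\<close> is at least \<open>1 - 1 / n\<close>, and for \<open>a = 1\<close> and \<open>b \<rightarrow> \<infinity>\<close> the ratio of the two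
  tends to this bound.\<close>

definition encode :: "'a list \<times> 'a list \<Rightarrow> nat list \<Rightarrow> 'a list" where
  "encode v is = concat (map (codeword v) is)"

lemma encode_Nil [simp]: "encode v [] = []"
  and encode_Cons [simp]: "encode v (i # is) = codeword v i @ encode v is"
  and encode_append [simp]: "encode v (is @ js) = encode v is @ encode v js"
  by (simp_all add: encode_def)

lemma codeword_pair [simp]:
  "codeword (u, v) 1 = u" "codeword (u, v) (Suc 0) = u" "codeword (u, v) 2 = v"
  by (simp_all add: codeword_def)

lemma is_uniquely_decodable_iff_inj_on:
  "is_uniquely_decodable v \<longleftrightarrow> inj_on (encode v) (lists {1, 2})"
proof
  assume ud: "is_uniquely_decodable v"
  show "inj_on (encode v) (lists {1, 2})"
  proof (rule inj_onI)
    fix "is" js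
    assume "is \<in> lists {1, 2}" "js \<in> lists {1, 2}" "encode v is = encode v js"
    then have "set (is @ [1]) \<subseteq> {1, 2}" "set (js @ [1]) \<subseteq> {1, 2}"
      "encode v (is @ [1]) = encode v (js @ [1])"
      by auto
    then have "is @ [1] = js @ [1]"
      using ud unfolding is_uniquely_decodable_def encode_def by blast
    then show "is = js" by simp
  qed
next
  assume "inj_on (encode v) (lists {1, 2})"
  then show "is_uniquely_decodable v"
    unfolding is_uniquely_decodable_def encode_def inj_on_def in_lists_conv_set by blast
qed

lemma encode_in_lists:
  assumes "is \<in> lists A" "js \<in> lists A"
  shows "encode (is, js) ks \<in> lists A"
  using assms by (induction ks) (auto simp: codeword_def)

lemma encode_encode: "encode v (encode (is, js) ks) = encode (encode v is, encode v js) ks"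
  by (induction ks) (simp_all add: codeword_def)

lemma is_uniquely_decodable_compose:
  assumes "is_uniquely_decodable v" "is_uniquely_decodable (is, js)"
    and "is \<in> lists {1, 2}" "js \<in> lists {1, 2}"
  shows "is_uniquely_decodable (encode v is, encode v js)"
proof -
  have "inj_on (encode v \<circ> encode (is, js)) (lists {1, 2})"
  proof (rule comp_inj_on)
    show "inj_on (encode (is, js)) (lists {1, 2})"
      using assms(2) by (simp only: is_uniquely_decodable_iff_inj_on)
    have "encode (is, js) ` lists {1, 2} \<subseteq> lists {1, 2}"
      using encode_in_lists[OF assms(3,4)] by blast
    with assms(1) show "inj_on (encode v) (encode (is, js) ` lists {1, 2})"
      by (auto simp only: is_uniquely_decodable_iff_inj_on intro: inj_on_subset)
  qed
  also have "encode v \<circ> encode (is, js) = encode (encode v is, encode v js)"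
    by (simp add: fun_eq_iff encode_encode)
  finally show ?thesis
    by (simp only: is_uniquely_decodable_iff_inj_on)
qed

lemma is_prefix_code_iff_parallel: "is_prefix_code (u, v) \<longleftrightarrow> u \<parallel> v"
  by (auto simp: is_prefix_code_def)

lemma is_uniquely_decodable_swap:
  assumes "is_uniquely_decodable (u, v)"
  shows "is_uniquely_decodable (v, u)"
proof -
  have "is_uniquely_decodable ([2], [1 :: nat])"
    by (rule is_prefix_code_imp_uniquely_decodable) (simp add: is_prefix_code_def)
  from is_uniquely_decodable_compose[OF assms this] show ?thesis by simp
qed

lemma is_uniquely_decodable_append:
  assumes "is_uniquely_decodable (u, v)"
  shows "is_uniquely_decodable (u, u @ v)"
proof -
  \<comment> \<open>\<open>([1], [1, 2])\<close> is not a prefix code, but the last letter of a message identifies its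
    last codeword.\<close>
  have "is = js" if "is \<in> lists {1, 2}" "js \<in> lists {1, 2}"
    "encode ([1], [1, 2 :: nat]) is = encode ([1], [1, 2]) js" for "is" js
    using that
  proof (induction "is" arbitrary: js rule: rev_induct)
    case Nil
    then show ?case by (cases js) (auto simp: codeword_def split: if_splits)
  next
    case (snoc i "is")
    then show ?case by (cases js rule: rev_cases) (auto simp: codeword_def split: if_splits)
  qed
  then have "is_uniquely_decodable ([1], [1, 2 :: nat])"
    unfolding is_uniquely_decodable_iff_inj_on by (intro inj_onI)
  from is_uniquely_decodable_compose[OF assms this] show ?thesis by simp
qed

lemma is_uniquely_decodable_if_not_commute:
  assumes "u @ v \<noteq> v @ u"
  shows "is_uniquely_decodable (u, v)"
  using assms
proof (induction "length u + length v" arbitrary: u v rule: less_induct)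
  case less
  have "u \<noteq> []" "v \<noteq> []" using less.prems by auto
  consider (parallel) "u \<parallel> v"
    | (extend_fst) z where "v = u @ z"
    | (extend_snd) z where "u = v @ z"
    by (auto elim!: prefixE)
  then show ?case
  proof cases
    case parallel
    then show ?thesis
      by (intro is_prefix_code_imp_uniquely_decodable) (simp only: is_prefix_code_iff_parallel)
  next
    case (extend_fst z)
    have "is_uniquely_decodable (u, z)"
      using less \<open>u \<noteq> []\<close> extend_fst by simp
    then show ?thesis
      unfolding extend_fst by (rule is_uniquely_decodable_append)
  next
    case (extend_snd z)
    have "is_uniquely_decodable (v, z)"
      using less \<open>v \<noteq> []\<close> extend_snd by simp
    then show ?thesis
      unfolding extend_snd by (rule is_uniquely_decodable_swap[OF is_uniquely_decodable_append])
  qed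
qed

lemma is_uniquely_decodable_iff_not_commute:
  "is_uniquely_decodable (u, v) \<longleftrightarrow> u @ v \<noteq> v @ u"
proof
  assume "is_uniquely_decodable (u, v)"
  then have inj: "inj_on (encode (u, v)) (lists {1, 2})"
    by (simp only: is_uniquely_decodable_iff_inj_on)
  show "u @ v \<noteq> v @ u"
  proof
    assume "u @ v = v @ u"
    then have "encode (u, v) [1, 2] = encode (u, v) [2, 1]" by simp
    with inj have "[1, 2] = [2, 1 :: nat]" by (rule inj_onD) simp_all
    then show False by simp
  qed
qed (rule is_uniquely_decodable_if_not_commute)

abbreviation word_power :: "'a list \<Rightarrow> nat \<Rightarrow> 'a list" where
  "word_power w k \<equiv> concat (replicate k w)"

lemma word_power_add: "word_power w (j + k) = word_power w j @ word_power w k"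
  by (simp add: replicate_add)

lemma word_power_mult: "word_power w (j * k) = word_power (word_power w j) k"
  by (induction k) (simp_all add: replicate_add)

lemma length_word_power: "length (word_power w k) = k * length w"
  by (induction k) simp_all

lemma word_power_commute: "word_power w j @ word_power w k = word_power w k @ word_power w j"
  by (metis add.commute word_power_add)

lemma commute_imp_powers_of_gcd_word:
  assumes "u @ v = v @ u" "u \<noteq> []"
  defines "g \<equiv> gcd (length u) (length v)"
  obtains w where "length w = g"
    and "u = word_power w (length u div g)" "v = word_power w (length v div g)"
proof -
  obtain j k z where u: "word_power z j = u" and v: "word_power z k = v"
    using comm_append_are_replicate[OF assms(1)] by blast
  have g: "g = gcd j k * length z"
    by (simp add: g_def length_word_power gcd_mult_right gcd.commute flip: u v)
  have "z \<noteq> []" "j > 0" using u assms(2) by auto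
  show thesis
  proof
    let ?w = "word_power z (gcd j k)"
    show "length ?w = g" by (simp add: g length_word_power)
    have "length u div g = j div gcd j k" "length v div g = k div gcd j k"
      using \<open>z \<noteq> []\<close> by (simp_all add: g length_word_power flip: u v)
    then show "u = word_power ?w (length u div g)" "v = word_power ?w (length v div g)"
      by (simp_all add: u v flip: word_power_mult)
  qed
qed

abbreviation words :: "'a set \<Rightarrow> nat \<Rightarrow> 'a list set" where
  "words X k \<equiv> {w. set w \<subseteq> X \<and> length w = k}"

lemma codes_eq_Times: "codes X (a, b) = words X a \<times> words X b"
  by (auto simp: codes_def)

lemma
  assumes "finite X"
  shows finite_codes: "finite (codes X (a, b))"
    and card_codes: "card (codes X (a, b)) = card X ^ (a + b)"
  using assms
  by (simp_all add: codes_eq_Times finite_lists_length_eq card_cartesian_product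
      card_lists_length_eq power_add)

lemma real_card_Diff_image:
  assumes "finite A" "inj_on f B" "f ` B \<subseteq> A"
  shows "real (card (A - f ` B)) = real (card A) - real (card B)"
proof -
  have "card B \<le> card A"
    using assms by (rule card_inj_on_le[rotated -1])
  moreover have "card (A - f ` B) = card A - card B"
    using assms by (simp add: card_Diff_subset finite_subset card_image)
  ultimately show ?thesis by (simp add: of_nat_diff)
qed

definition prefix_pair :: "nat \<Rightarrow> nat \<Rightarrow> 'a list \<Rightarrow> 'a list \<times> 'a list" where
  "prefix_pair a b w = (take a w, take b w)"

lemma inj_on_prefix_pair: "inj_on (prefix_pair a b) (words X (max a b))"
  by (rule inj_onI) (auto simp: prefix_pair_def max_def split: if_splits)

lemma prefix_pair_image_subset_codes: "prefix_pair a b ` words X (max a b) \<subseteq> codes X (a, b)"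
  by (auto simp: prefix_pair_def codes_eq_Times dest: in_set_takeD)

lemma parallel_iff_not_prefix_pair:
  assumes "(u, v) \<in> codes X (a, b)"
  shows "u \<parallel> v \<longleftrightarrow> (u, v) \<notin> prefix_pair a b ` words X (max a b)"
proof
  assume "u \<parallel> v"
  then show "(u, v) \<notin> prefix_pair a b ` words X (max a b)"
    using prefix_same_cases[OF take_is_prefix take_is_prefix] by (auto simp: prefix_pair_def)
next
  assume not_image: "(u, v) \<notin> prefix_pair a b ` words X (max a b)"
  have "(u, v) = prefix_pair a b v \<and> v \<in> words X (max a b)" if "prefix u v"
    using that assms by (auto simp: prefix_pair_def codes_eq_Times prefix_def)
  moreover have "(u, v) = prefix_pair a b u \<and> u \<in> words X (max a b)" if "prefix v u"
    using that assms by (auto simp: prefix_pair_def codes_eq_Times prefix_def)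
  ultimately show "u \<parallel> v" using not_image by blast
qed

lemma PR_eq_codes_Diff: "PR X (a, b) = codes X (a, b) - prefix_pair a b ` words X (max a b)"
proof -
  have "is_prefix_code p \<longleftrightarrow> p \<notin> prefix_pair a b ` words X (max a b)"
    if "p \<in> codes X (a, b)" for p
    using that by (cases p) (simp only: is_prefix_code_iff_parallel parallel_iff_not_prefix_pair)
  then show ?thesis
    unfolding PR_def by blast
qed

lemma card_PR:
  assumes "finite X"
  shows "real (card (PR X (a, b))) = real (card X) ^ (a + b) - real (card X) ^ max a b"
  using assms
  by (simp add: PR_eq_codes_Diff real_card_Diff_image inj_on_prefix_pair
      prefix_pair_image_subset_codes finite_codes card_codes card_lists_length_eq)

definition power_pair :: "nat \<Rightarrow> nat \<Rightarrow> 'a list \<Rightarrow> 'a list \<times> 'a list" where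
  "power_pair a b w = (word_power w (a div gcd a b), word_power w (b div gcd a b))"

lemma inj_on_power_pair:
  assumes "a > 0"
  shows "inj_on (power_pair a b) (words X d)"
proof (rule inj_onI)
  fix w w'
  assume "w \<in> words X d" "w' \<in> words X d" "power_pair a b w = power_pair a b w'"
  then have "replicate (a div gcd a b) w = replicate (a div gcd a b) w'"
    by (intro concat_injective) (auto simp: power_pair_def set_zip)
  moreover have "a div gcd a b > 0"
    using assms by (simp add: div_greater_zero_iff gcd_le1_nat)
  ultimately show "w = w'" by simp
qed

lemma power_pair_image_subset_codes: "power_pair a b ` words X (gcd a b) \<subseteq> codes X (a, b)"
  by (auto simp: power_pair_def codes_eq_Times length_word_power)

lemma commute_iff_power_pair:
  assumes "(u, v) \<in> codes X (a, b)" "a > 0"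
  shows "u @ v = v @ u \<longleftrightarrow> (u, v) \<in> power_pair a b ` words X (gcd a b)"
proof
  assume "(u, v) \<in> power_pair a b ` words X (gcd a b)"
  then show "u @ v = v @ u"
    unfolding power_pair_def using word_power_commute by blast
next
  have len: "length u = a" "length v = b" and "set u \<subseteq> X"
    using assms(1) by (auto simp: codes_eq_Times)
  then have "u \<noteq> []" using assms(2) by auto
  moreover assume "u @ v = v @ u"
  ultimately obtain w where "length w = gcd a b" and powers: "(u, v) = power_pair a b w"
    using commute_imp_powers_of_gcd_word[of u v] unfolding len power_pair_def by blast
  moreover have "set w \<subseteq> X"
    using \<open>u \<noteq> []\<close> \<open>set u \<subseteq> X\<close> powers
    by (auto simp: power_pair_def set_replicate_conv_if split: if_splits)
  ultimately show "(u, v) \<in> power_pair a b ` words X (gcd a b)" by blast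
qed

lemma UD_eq_codes_Diff:
  assumes "a > 0"
  shows "UD X (a, b) = codes X (a, b) - power_pair a b ` words X (gcd a b)"
proof -
  have "is_uniquely_decodable p \<longleftrightarrow> p \<notin> power_pair a b ` words X (gcd a b)"
    if "p \<in> codes X (a, b)" for p
    using that assms
    by (cases p) (simp only: is_uniquely_decodable_iff_not_commute commute_iff_power_pair)
  then show ?thesis
    unfolding UD_def by blast
qed

lemma card_UD:
  assumes "finite X" "a > 0"
  shows "real (card (UD X (a, b))) = real (card X) ^ (a + b) - real (card X) ^ gcd a b"
  using assms
  by (simp add: UD_eq_codes_Diff real_card_Diff_image inj_on_power_pair
      power_pair_image_subset_codes finite_codes card_codes card_lists_length_eq)

lemma card_UD_pos:
  assumes "finite X" "card X \<ge> 2" "a > 0" "b > 0"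
  shows "card (UD X (a, b)) > 0"
proof -
  have "gcd a b < a + b"
    using gcd_le1_nat[of a b] assms(3,4) by linarith
  then have "real (card X) ^ gcd a b < real (card X) ^ (a + b)"
    using assms(2) by (intro power_strict_increasing) auto
  then have "0 < real (card (UD X (a, b)))"
    using assms by (simp add: card_UD)
  then show ?thesis by simp
qed

lemma prefix_code_ratio_ge:
  assumes "finite X" "card X \<ge> 2" "a > 0" "b > 0"
  shows "1 - 1 / real (card X) \<le> real (card (PR X (a, b))) / real (card (UD X (a, b)))"
proof -
  let ?n = "real (card X)"
  have "?n * ?n ^ max a b \<le> ?n ^ (a + b)"
    unfolding power_Suc[symmetric] using assms by (intro power_increasing) auto
  then have "(1 - 1 / ?n) * ?n ^ (a + b) \<le> real (card (PR X (a, b)))"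
    using assms by (simp add: card_PR field_simps)
  moreover have "real (card (UD X (a, b))) \<le> ?n ^ (a + b)"
    using assms by (simp add: card_UD)
  then have "(1 - 1 / ?n) * real (card (UD X (a, b))) \<le> (1 - 1 / ?n) * ?n ^ (a + b)"
    using assms by (intro mult_left_mono) auto
  ultimately show ?thesis
    using card_UD_pos[OF assms] by (simp add: le_divide_eq)
qed

lemma prefix_code_ratio_one_tendsto:
  assumes "finite X" "card X \<ge> 2"
  shows "(\<lambda>b. real (card (PR X (1, Suc b))) / real (card (UD X (1, Suc b))))
    \<longlonglongrightarrow> 1 - 1 / real (card X)"
proof -
  let ?n = "real (card X)"
  have "real (card (PR X (1, Suc b))) / real (card (UD X (1, Suc b))) =
      (1 - 1 / ?n) / (1 - (1 / ?n) ^ Suc b)" for b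
  proof -
    have "real (card (PR X (1, Suc b))) = ?n ^ (b + 2) * (1 - 1 / ?n)"
      using assms by (simp add: card_PR field_simps)
    moreover have "real (card (UD X (1, Suc b))) = ?n ^ (b + 2) * (1 - (1 / ?n) ^ Suc b)"
      using assms by (simp add: card_UD field_simps)
    ultimately show ?thesis using assms by auto
  qed
  moreover have "(\<lambda>b. (1 / ?n) ^ Suc b) \<longlonglongrightarrow> 0"
    using assms by (intro LIMSEQ_Suc LIMSEQ_power_zero) auto
  then have "(\<lambda>b. (1 - 1 / ?n) / (1 - (1 / ?n) ^ Suc b)) \<longlonglongrightarrow> (1 - 1 / ?n) / (1 - 0)"
    by (intro tendsto_divide tendsto_diff tendsto_const) auto
  ultimately show ?thesis by simp
qed

theorem corollary5:
  fixes X :: "'a set" and n :: nat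
  assumes "finite X" and "card X = n" and "n \<ge> 2"
  shows "xi2 X = 1 - 1 / real n"
proof (rule antisym)
  let ?I = "{(a, b). a > 0 \<and> b > 0 \<and> UD X (a, b) \<noteq> {}}"
  let ?ratio = "\<lambda>L. real (card (PR X L)) / real (card (UD X L))"
  have X: "finite X" "card X \<ge> 2" using assms by simp_all
  have in_I: "(1, Suc b) \<in> ?I" for b
    using card_UD_pos[OF X, of 1 "Suc b"] by auto
  show "1 - 1 / real n \<le> xi2 X"
    unfolding xi2_def
  proof (rule cINF_greatest)
    show "?I \<noteq> {}" using in_I by (metis empty_iff)
    show "1 - 1 / real n \<le> ?ratio L" if "L \<in> ?I" for L
      using that prefix_code_ratio_ge[OF X] assms(2) by auto
  qed
  have "xi2 X \<le> ?ratio (1, Suc b)" for b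
    unfolding xi2_def by (rule cINF_lower[OF _ in_I]) (auto intro!: bdd_belowI[of _ 0])
  with prefix_code_ratio_one_tendsto[OF X] show "xi2 X \<le> 1 - 1 / real n"
    unfolding assms(2) by (intro LIMSEQ_le_const) auto
qed

end
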